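(* Let $V\subset\Omega$ be a finite subset and let $S:\Omega\to V$ be a Borel map. Then $$\operatorname{esssup}_{x\in\Omega}|S(x)-x|\ge\frac{\Gamma\left(\frac d2+1\right)^{1/d}\,\mathfrak L^d(\Omega)^{1/d}}{\pi^{1/2}|V|^{1/d}}.$$
   Context: $d\in\mathbb N=\{1,2,\dots\}$ and $\Omega\subset\mathbb R^d$ is open and bounded with Lipschitz boundary. $\mathfrak L^d$ is Lebesgue measure on $\mathbb R^d$, $\operatorname{esssup}_{x\in\Omega}$ is the usual essential supremum over $\Omega$ with respect to Lebesgue measure, $\Gamma$ is Euler's gamma function, and $|V|$ is the cardinality of $V$. *)

theory Defs
  imports "HOL-Analysis.Analysis" "HOL-Probability.Essential_Supremum"
begin

text \<open>
  Near each boundary point the set is, in suitable orthonormal coordinates, the strict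
  epigraph of a Lipschitz function of the first \<open>d - 1\<close> coordinates. The unit vector \<open>e\<close> is the
  direction of the last coordinate axis; the other coordinates of \<open>x\<close> are represented by its
  orthogonal projection \<open>x - (x \<bullet> e) *\<^sub>R e\<close> onto the hyperplane orthogonal to \<open>e\<close>, and only the
  values of \<open>g\<close> on that hyperplane matter.
\<close>

definition lipschitz_boundary :: "'a::euclidean_space set \<Rightarrow> bool" where
  "lipschitz_boundary A \<longleftrightarrow>
    (\<forall>p\<in>frontier A. \<exists>r>0. \<exists>e. norm e = 1 \<and>
      (\<exists>g :: 'a \<Rightarrow> real. (\<exists>C. C-lipschitz_on {y. y \<bullet> e = 0} g) \<and>
        A \<inter> ball p r = {x \<in> ball p r. x \<bullet> e > g (x - (x \<bullet> e) *\<^sub>R e)}))"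

end

theory Submission
  imports Defs
begin

text \<open>
  If the essential supremum is a finite number \<open>R\<close>, then almost every point of \<open>\<Omega>\<close> lies within
  distance \<open>R\<close> of its image under \<open>S\<close>, hence in one of the \<open>card V\<close> closed balls of radius \<open>R\<close>
  centred at the points of \<open>V\<close>. So the volume of \<open>\<Omega>\<close> is at most
  \<open>card V * \<omega> * R ^ d\<close>, where \<open>\<omega> = pi powr (d / 2) / Gamma (d / 2 + 1)\<close> is the volume of
  the unit ball (\<open>measure_le_of_ae_covered_by_cballs\<close>). Solving for \<open>R\<close>
  (\<open>quantization_radius_le\<close>) gives the bound.
\<close>

lemma measure_le_of_ae_covered_by_cballs:
  fixes A V :: "'a::euclidean_space set"
  assumes A: "A \<in> sets lebesgue" and V: "finite V" and R: "0 \<le> R"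
    and cover: "AE x in lebesgue_on A. \<exists>v\<in>V. dist v x \<le> R"
  shows "measure lebesgue A \<le> real (card V) * (unit_ball_vol DIM('a) * R ^ DIM('a))"
proof -
  have "AE x in lebesgue. x \<in> A \<longrightarrow> x \<in> (\<Union>v\<in>V. cball v R)"
    using cover A by (simp add: AE_restrict_space_iff)
  then have "emeasure lebesgue A \<le> emeasure lebesgue (\<Union>v\<in>V. cball v R)"
    using V by (intro emeasure_mono_AE sets.finite_UN) auto
  also have "\<dots> \<le> (\<Sum>v\<in>V. emeasure lebesgue (cball v R))"
    using V by (intro emeasure_subadditive_finite) auto
  also have "\<dots> = (\<Sum>v\<in>V. ennreal (unit_ball_vol DIM('a) * R ^ DIM('a)))"
    using R by (simp add: emeasure_cball)
  also have "\<dots> = ennreal (real (card V) * (unit_ball_vol DIM('a) * R ^ DIM('a)))"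
    using R by (simp add: ennreal_mult ennreal_of_nat_eq_real_of_nat)
  finally show ?thesis
    unfolding measure_def using R by (intro enn2real_leI) auto
qed

text \<open>
  Taking \<open>d\<close>-th roots in \<open>m \<le> k * \<omega> * R ^ d\<close>: the root of \<open>\<omega>\<close> is
  \<open>pi powr (1 / 2)\<close> divided by the root of \<open>Gamma (d / 2 + 1)\<close>. For \<open>k = 0\<close> the
  division by zero makes the left-hand side of the conclusion \<open>0\<close>.
\<close>

lemma quantization_radius_le:
  fixes m R :: real and d k :: nat
  assumes d: "0 < d" and m: "0 \<le> m" and R: "0 \<le> R"
    and le: "m \<le> real k * (unit_ball_vol d * R ^ d)"
  shows "Gamma (real d / 2 + 1) powr (1 / real d) * m powr (1 / real d) /
      (pi powr (1 / 2) * real k powr (1 / real d)) \<le> R"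
proof (cases "k = 0")
  case True
  then show ?thesis using R by simp
next
  case False
  define G where "G = Gamma (real d / 2 + 1)"
  have G: "0 < G" unfolding G_def by (intro Gamma_real_pos) auto
  have "G * m \<le> G * (real k * (unit_ball_vol d * R ^ d))"
    using le G by (intro mult_left_mono) auto
  also have "\<dots> = real k * (pi powr (real d / 2) * R ^ d)"
    using G by (simp add: unit_ball_vol_def G_def[symmetric])
  finally have "(G * m) powr (1 / d) \<le> (real k * (pi powr (real d / 2) * R ^ d)) powr (1 / d)"
    using G m by (intro powr_mono2) auto
  also have "\<dots> = real k powr (1 / d) * (pi powr (1 / 2) * (R ^ d) powr (1 / d))"
    using d R by (simp add: powr_mult powr_powr)
  also have "(R ^ d) powr (1 / d) = R"
    using d R by (cases "R = 0") (simp_all add: powr_realpow[symmetric] powr_powr)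
  finally have "G powr (1 / d) * m powr (1 / d) \<le> real k powr (1 / d) * (pi powr (1 / 2) * R)"
    using G m by (simp add: powr_mult)
  then show ?thesis
    unfolding G_def[symmetric] using False by (simp add: field_simps)
qed

theorem lemma4p2:
  fixes \<Omega> V :: "(real ^ 'd) set" and S :: "real ^ 'd \<Rightarrow> real ^ 'd"
  assumes "open \<Omega>" and "bounded \<Omega>" and "lipschitz_boundary \<Omega>"
    and "V \<subseteq> \<Omega>" and "finite V"
    and "S ` \<Omega> \<subseteq> V" and "S \<in> borel_measurable (restrict_space borel \<Omega>)"
  shows "esssup (lebesgue_on \<Omega>) (\<lambda>x. ennreal (norm (S x - x))) \<ge>
    ennreal (Gamma (real CARD('d) / 2 + 1) powr (1 / real CARD('d)) *
               measure lebesgue \<Omega> powr (1 / real CARD('d)) /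
             (pi powr (1 / 2) * real (card V) powr (1 / real CARD('d))))"
proof (cases "esssup (lebesgue_on \<Omega>) (\<lambda>x. ennreal (norm (S x - x)))")
  case top
  then show ?thesis by simp
next
  case (real R)
  have \<Omega>: "\<Omega> \<in> sets lebesgue" using \<open>open \<Omega>\<close> by (simp add: borel_open sets_completionI_sets)
  have "AE x in lebesgue_on \<Omega>. ennreal (norm (S x - x)) \<le> ennreal R"
    using esssup_AE[of "\<lambda>x. ennreal (norm (S x - x))" "lebesgue_on \<Omega>"] real by simp
  moreover have "AE x in lebesgue_on \<Omega>. S x \<in> V"
    using \<open>S ` \<Omega> \<subseteq> V\<close> by (intro AE_I2) auto
  ultimately have "AE x in lebesgue_on \<Omega>. \<exists>v\<in>V. dist v x \<le> R"
    by eventually_elim (use real in \<open>auto simp: dist_norm\<close>)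
  from measure_le_of_ae_covered_by_cballs[OF \<Omega> \<open>finite V\<close> _ this]
  have "measure lebesgue \<Omega> \<le> real (card V) * (unit_ball_vol CARD('d) * R ^ CARD('d))"
    using real by simp
  then show ?thesis
    using real by (auto intro!: ennreal_leI quantization_radius_le)
qed

end
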